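(* Let $(X,d,\ll,\leq,\tau)$ be a Lorentzian pre-length space and let $\Omega\colon X\to(0,+\infty)$ be continuous. The conformal length functional $L_\Omega^\tau$ satisfies the following properties. (i) For any causal curve $\gamma\colon[a,b]\to X$ and any $\delta>0$, $$L_\Omega^\tau(\gamma)=\inf\{V_{\Omega,\sigma}(\gamma) : \sigma \text{ is a partition of } [a,b] \text{ with } |\sigma|<\delta\},$$ where for $\sigma=\{t_i\}_{i=0}^m$ we put $|\sigma|:=\max_{i=0,\dots,m-1}|t_{i+1}-t_i|$. (ii) $L_\Omega^\tau$ is additive: for any causal curve $\gamma\colon[a,b]\to X$ and any $s\in[a,b]$, $$L_\Omega^\tau(\gamma)=L_\Omega^\tau(\gamma|_{[a,s]})+L_\Omega^\tau(\gamma|_{[s,b]}).$$ (iii) $L_\Omega^\tau$ is invariant under reparametrization: if $\gamma\colon[a,b]\to X$ is a causal curve and $\phi\colon[c,d']\to[a,b]$ is an increasing Lipschitz homeomorphism, then $L_\Omega^\tau(\gamma)=L_\Omega^\tau(\gamma\circ\phi)$.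
   Context: A Lorentzian pre-length space $(X,d,\ll,\leq,\tau)$ consists of a set $X$, a metric $d$ on $X$, two transitive relations $\ll,\leq$ on $X$ with $\leq$ reflexive and $\ll$ contained in $\leq$, and a map $\tau\colon X\times X\to[0,+\infty]$ which is lower semicontinuous with respect to the topology of $d$, satisfies $\tau(x,z)\geq\tau(x,y)+\tau(y,z)$ whenever $x\leq y\leq z$, satisfies $\tau(x,y)=0$ if $x\not\leq y$, and satisfies $\tau(x,y)>0$ if and only if $x\ll y$. A curve is a continuous map from an interval into $X$. A non-constant curve $\gamma\colon I\to X$ is causal if $\gamma(t)\leq\gamma(s)$ for all $t<s$ in $I$. For a causal curve $\gamma\colon[a,b]\to X$ and a partition $\sigma=\{a=t_0<\dots<t_m=b\}$ put $$V_{\Omega,\sigma}(\gamma):=\sum_{i=0}^{m-1}\max_{t\in[t_i,t_{i+1}]}\Omega(\gamma(t))\,\tau(\gamma(t_i),\gamma(t_{i+1})),\qquad L_\Omega^\tau(\gamma):=\inf\{V_{\Omega,\sigma}(\gamma):\sigma\text{ a partition of }[a,b]\}\in[0,+\infty].$$ The same formulas are used for restrictions of causal curves to subintervals (over a degenerate interval $[s,s]$ the sum is empty and the length is $0$). *)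

theory Defs
  imports "HOL-Analysis.Analysis"
begin

text \<open>The underlying set is the whole type and the metric \<open>d\<close> is its \<open>dist\<close>; the topology on pairs
  is the product topology.\<close>

locale Lorentzian_pre_length_space =
  fixes ll :: "'a::metric_space \<Rightarrow> 'a \<Rightarrow> bool"  (infix \<open>\<lless>\<close> 50)
    and le :: "'a \<Rightarrow> 'a \<Rightarrow> bool"  (infix \<open>\<preceq>\<close> 50)
    and \<tau> :: "'a \<Rightarrow> 'a \<Rightarrow> ennreal"
  assumes ll_trans: "transp (\<lless>)"
    and le_trans: "transp (\<preceq>)"
    and le_refl: "reflp (\<preceq>)"
    and ll_imp_le: "x \<lless> y \<Longrightarrow> x \<preceq> y"
    and tau_lower_semicontinuous: "open {p :: 'a \<times> 'a. c < \<tau> (fst p) (snd p)}"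
    and tau_reverse_triangle: "x \<preceq> y \<Longrightarrow> y \<preceq> z \<Longrightarrow> \<tau> x y + \<tau> y z \<le> \<tau> x z"
    and tau_eq_0: "\<not> x \<preceq> y \<Longrightarrow> \<tau> x y = 0"
    and tau_pos_iff: "0 < \<tau> x y \<longleftrightarrow> x \<lless> y"

text \<open>Curves on \<open>[a,b]\<close> are functions on the reals of which only the values on \<open>{a..b}\<close> matter;
  a restriction to a subinterval is expressed by changing the endpoints. Non-constancy forces
  \<open>a < b\<close>.\<close>

definition causal_curve ::
    "('a::metric_space \<Rightarrow> 'a \<Rightarrow> bool) \<Rightarrow> real \<Rightarrow> real \<Rightarrow> (real \<Rightarrow> 'a) \<Rightarrow> bool" where
  "causal_curve le a b \<gamma> \<longleftrightarrow>
     continuous_on {a..b} \<gamma> \<and> \<not> \<gamma> constant_on {a..b} \<and>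
     (\<forall>t\<in>{a..b}. \<forall>s\<in>{a..b}. t < s \<longrightarrow> le (\<gamma> t) (\<gamma> s))"

text \<open>A partition \<open>a = t\<^sub>0 < \<dots> < t\<^sub>m = b\<close> is the list \<open>[t\<^sub>0, \<dots>, t\<^sub>m]\<close>. The only partition of
  \<open>[s,s]\<close> is \<open>[s]\<close>, with \<open>m = 0\<close>.\<close>

definition interval_partition :: "real \<Rightarrow> real \<Rightarrow> real list \<Rightarrow> bool" where
  "interval_partition a b ts \<longleftrightarrow>
     ts \<noteq> [] \<and> sorted_wrt (<) ts \<and> hd ts = a \<and> last ts = b"

text \<open>Unspecified for \<open>m = 0\<close>, i.e. on a degenerate interval.\<close>

definition mesh :: "real list \<Rightarrow> real" where
  "mesh ts = Max ((\<lambda>i. \<bar>ts ! Suc i - ts ! i\<bar>) ` {..<length ts - 1})"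

text \<open>\<open>GREATEST\<close> is the maximum of the set of values; \<open>Max\<close> would require that set to be finite.\<close>

definition conformal_variation ::
    "('a \<Rightarrow> 'a \<Rightarrow> ennreal) \<Rightarrow> ('a \<Rightarrow> real) \<Rightarrow> (real \<Rightarrow> 'a) \<Rightarrow> real list \<Rightarrow> ennreal" where
  "conformal_variation \<tau> \<Omega> \<gamma> ts =
     (\<Sum>i<length ts - 1.
        ennreal (GREATEST y. y \<in> (\<lambda>t. \<Omega> (\<gamma> t)) ` {ts ! i..ts ! Suc i})
          * \<tau> (\<gamma> (ts ! i)) (\<gamma> (ts ! Suc i)))"

definition conformal_length ::
    "('a \<Rightarrow> 'a \<Rightarrow> ennreal) \<Rightarrow> ('a \<Rightarrow> real) \<Rightarrow> real \<Rightarrow> real \<Rightarrow> (real \<Rightarrow> 'a) \<Rightarrow> ennreal" where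
  "conformal_length \<tau> \<Omega> a b \<gamma> =
     Inf {conformal_variation \<tau> \<Omega> \<gamma> ts | ts. interval_partition a b ts}"

end

theory Submission
  imports Defs
begin

text \<open>
  For a fixed curve \<open>\<gamma>\<close>, give each pair of parameters \<open>x < y\<close> the cost
  \<open>f x y = (max of \<Omega> \<circ> \<gamma> on [x,y]) * \<tau> (\<gamma> x) (\<gamma> y)\<close>; the variation over a partition is the sum of
  the costs of its steps. Everything rests on one inequality, \<open>f x y + f y z \<le> f x z\<close>
  (\<open>conformal_cost_reverse_triangle\<close>): shrinking an interval can only lower the maximum, and along a
  causal curve \<open>\<tau>\<close> satisfies the reverse triangle inequality. Hence refining a partition never
  increases its variation.

  Every partition has refinements of arbitrarily small mesh, so restricting the infimum to fine
  partitions does not change it. Likewise every partition of \<open>[a,b]\<close> can be refined to contain a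
  given \<open>s\<close>, where it falls apart into partitions of \<open>[a,s]\<close> and \<open>[s,b]\<close>; this gives
  one half of additivity. The other half is that two such partitions can be glued.

  For reparametrization, an increasing homeomorphism \<open>\<phi>\<close> carries partitions to partitions
  bijectively, and each step to a step of the same cost, since \<open>\<phi>\<close> maps \<open>[x,y]\<close> onto
  \<open>[\<phi> x, \<phi> y]\<close>. So the two infima range over the same set of sums.
\<close>

section \<open>Partitions of an interval\<close>

lemma interval_partition_singleton [simp]: "interval_partition a b [x] \<longleftrightarrow> x = a \<and> x = b"
  by (auto simp: interval_partition_def)

lemma interval_partition_Cons_Cons [simp]:
  "interval_partition a b (x # y # zs) \<longleftrightarrow> x = a \<and> x < y \<and> interval_partition y b (y # zs)"
  by (auto simp: interval_partition_def)

lemma interval_partition_hd: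
  "interval_partition a b ts \<Longrightarrow> ts = a # tl ts"
  by (cases ts) (auto simp: interval_partition_def)

lemma interval_partition_le:
  "interval_partition a b ts \<Longrightarrow> a \<le> b"
proof (induction ts arbitrary: a)
  case (Cons x ts)
  then show ?case by (cases ts) fastforce+
qed (simp add: interval_partition_def)

text \<open>Induction from the right endpoint: the partition grows by steps prepended on the left.\<close>

lemma interval_partition_induct [consumes 1, case_names last step]:
  assumes "interval_partition a b ts"
    and "P b [b]"
    and "\<And>x y zs. x < y \<Longrightarrow> y \<le> b \<Longrightarrow> interval_partition y b (y # zs) \<Longrightarrow> P y (y # zs)
            \<Longrightarrow> P x (x # y # zs)"
  shows "P a ts"
  using assms(1)
proof (induction ts arbitrary: a)
  case Nil
  then show ?case by (simp add: interval_partition_def)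
next
  case (Cons x ts)
  show ?case
  proof (cases ts)
    case Nil
    then show ?thesis using Cons.prems assms(2) by auto
  next
    case (Cons y zs)
    then show ?thesis
      using Cons.prems Cons.IH[of y] assms(3)[of x y zs] interval_partition_le by auto
  qed
qed

lemma interval_partition_degenerate:
  assumes "interval_partition a a ts"
  shows "ts = [a]"
proof (cases "tl ts")
  case Nil
  then show ?thesis using interval_partition_hd[OF assms] by simp
next
  case (Cons y zs)
  then have ts: "ts = a # y # zs" using interval_partition_hd[OF assms] by simp
  have "a < y" "interval_partition y a (y # zs)" using assms unfolding ts by auto
  then show ?thesis using interval_partition_le by fastforce
qed

text \<open>Unlike a maximum over indices, \<open>successively\<close> unfolds along the list, so the bound can be
  carried through inductions and gluing. With \<open>a < b\<close> the maximum is over a nonempty set.\<close>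

lemma mesh_less_iff:
  assumes "interval_partition a b ts" and "a < b"
  shows "mesh ts < \<delta> \<longleftrightarrow> successively (\<lambda>x y. y - x < \<delta>) ts"
proof -
  have "length ts - 1 \<noteq> 0"
  proof
    assume "length ts - 1 = 0"
    then have "tl ts = []" by (cases ts) auto
    then have "ts = [a]" using interval_partition_hd[OF assms(1)] by simp
    then show False using assms by simp
  qed
  then have "mesh ts < \<delta> \<longleftrightarrow> (\<forall>i<length ts - 1. \<bar>ts ! Suc i - ts ! i\<bar> < \<delta>)"
    unfolding mesh_def by (subst Max_less_iff) (auto simp: lessThan_empty_iff)
  also have "\<dots> \<longleftrightarrow> (\<forall>i<length ts - 1. ts ! Suc i - ts ! i < \<delta>)"
  proof -
    have "ts ! i < ts ! Suc i" if "i < length ts - 1" for i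
      using assms(1) that by (auto simp: interval_partition_def sorted_wrt_iff_nth_less)
    then show ?thesis by (auto simp: abs_of_pos)
  qed
  also have "\<dots> \<longleftrightarrow> successively (\<lambda>x y. y - x < \<delta>) ts"
    by (auto simp: successively_conv_nth)
  finally show ?thesis .
qed

lemma fine_partition_exists:
  fixes a b \<delta> :: real
  assumes "a \<le> b" and "0 < \<delta>"
  shows "\<exists>ts. interval_partition a b ts \<and> successively (\<lambda>x y. y - x < \<delta>) ts"
proof -
  \<comment> \<open>Strides of length \<open>\<delta> / 2\<close> stay strictly below \<open>\<delta>\<close>; \<open>n\<close> of them cover \<open>[x,b]\<close>.\<close>
  have "\<exists>ts. interval_partition x b ts \<and> successively (\<lambda>x y. y - x < \<delta>) ts"
    if "x \<le> b" "b - x \<le> real n * (\<delta> / 2)" for n x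
    using that
  proof (induction n arbitrary: x)
    case 0
    then have "interval_partition x b [b] \<and> successively (\<lambda>x y. y - x < \<delta>) [b]" by simp
    then show ?case by blast
  next
    case (Suc n)
    show ?case
    proof (cases "b \<le> x + \<delta> / 2")
      case True
      let ?ts = "if x = b then [b] else [x, b]"
      have "interval_partition x b ?ts \<and> successively (\<lambda>x y. y - x < \<delta>) ?ts"
        using True Suc.prems assms by auto
      then show ?thesis by blast
    next
      case False
      let ?y = "x + \<delta> / 2"
      obtain ts where ts: "interval_partition ?y b ts" "successively (\<lambda>x y. y - x < \<delta>) ts"
        using Suc.IH[of ?y] Suc.prems False by (auto simp: algebra_simps)
      obtain zs where "ts = ?y # zs" using interval_partition_hd[OF ts(1)] by blast
      then have "interval_partition x b (x # ts) \<and> successively (\<lambda>x y. y - x < \<delta>) (x # ts)"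
        using ts assms by simp
      then show ?thesis by blast
    qed
  qed
  moreover obtain n where "(b - a) / (\<delta> / 2) \<le> real n" using real_arch_simple by blast
  then have "b - a \<le> real n * (\<delta> / 2)" using assms by (simp add: field_simps)
  ultimately show ?thesis using assms by blast
qed

section \<open>Sums of step costs\<close>

fun step_sum :: "('b \<Rightarrow> 'b \<Rightarrow> ennreal) \<Rightarrow> 'b list \<Rightarrow> ennreal" where
  "step_sum f (x # y # zs) = f x y + step_sum f (y # zs)"
| "step_sum f _ = 0"

definition reverse_triangle_on :: "real \<Rightarrow> real \<Rightarrow> (real \<Rightarrow> real \<Rightarrow> ennreal) \<Rightarrow> bool" where
  "reverse_triangle_on a b f \<longleftrightarrow>
     (\<forall>x y z. a \<le> x \<and> x < y \<and> y < z \<and> z \<le> b \<longrightarrow> f x y + f y z \<le> f x z)"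

lemma reverse_triangle_onD:
  "reverse_triangle_on a b f \<Longrightarrow> a \<le> x \<Longrightarrow> x < y \<Longrightarrow> y < z \<Longrightarrow> z \<le> b \<Longrightarrow> f x y + f y z \<le> f x z"
  unfolding reverse_triangle_on_def by blast

lemma reverse_triangle_on_mono:
  "reverse_triangle_on a b f \<Longrightarrow> a \<le> c \<Longrightarrow> d \<le> b \<Longrightarrow> reverse_triangle_on c d f"
  unfolding reverse_triangle_on_def by force

lemma step_sum_conv_nth:
  "step_sum f ts = (\<Sum>i<length ts - 1. f (ts ! i) (ts ! Suc i))"
  by (induction f ts rule: step_sum.induct) (simp_all add: sum.lessThan_Suc_shift del: sum.lessThan_Suc)

lemma step_sum_map:
  "step_sum f (map \<phi> ts) = step_sum (\<lambda>x y. f (\<phi> x) (\<phi> y)) ts"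
  by (induction ts rule: induct_list012) simp_all

lemma step_sum_cong:
  assumes "interval_partition a b ts"
    and "\<And>x y. a \<le> x \<Longrightarrow> x < y \<Longrightarrow> y \<le> b \<Longrightarrow> f x y = g x y"
  shows "step_sum f ts = step_sum g ts"
  using assms
  by (induction rule: interval_partition_induct) auto

text \<open>The common endpoint \<open>s\<close> ends the first list and starts the second; \<open>tl\<close> drops the
  duplicate. As the last step into \<open>s\<close> and the first step out of it are kept, any condition
  on consecutive points survives.\<close>

lemma step_sum_glue:
  assumes "interval_partition a s us" and "interval_partition s b vs"
  shows "interval_partition a b (us @ tl vs)"
    and "step_sum f (us @ tl vs) = step_sum f us + step_sum f vs"
    and "successively P us \<Longrightarrow> successively P vs \<Longrightarrow> successively P (us @ tl vs)"
proof -
  have "interval_partition a b (us @ tl vs)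
        \<and> step_sum f (us @ tl vs) = step_sum f us + step_sum f vs
        \<and> (successively P us \<longrightarrow> successively P vs \<longrightarrow> successively P (us @ tl vs))"
    using assms(1)
  proof (induction rule: interval_partition_induct)
    case last
    have "[s] @ tl vs = vs" using interval_partition_hd[OF assms(2)] by simp
    then show ?case using assms(2) by (simp del: append_Cons append_Nil)
  next
    case (step x y zs)
    then show ?case by (auto simp: add.assoc)
  qed
  then show "interval_partition a b (us @ tl vs)"
    and "step_sum f (us @ tl vs) = step_sum f us + step_sum f vs"
    and "successively P us \<Longrightarrow> successively P vs \<Longrightarrow> successively P (us @ tl vs)"
    by blast+
qed

text \<open>Only the step containing \<open>s\<close> is affected by inserting \<open>s\<close>, and the reverse triangle inequality
  controls the cost of the two halves.\<close>

lemma step_sum_split: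
  assumes "interval_partition a b ts" and "reverse_triangle_on a b f" and "s \<in> {a..b}"
  shows "\<exists>us vs. interval_partition a s us \<and> interval_partition s b vs
           \<and> step_sum f us + step_sum f vs \<le> step_sum f ts"
  using assms
proof (induction rule: interval_partition_induct)
  case last
  then have "interval_partition b s [b] \<and> interval_partition s b [b]
    \<and> step_sum f [b] + step_sum f [b] \<le> step_sum f [b]" by simp
  then show ?case by blast
next
  case (step x y zs)
  consider "s = x" | "x < s" "s < y" | "y \<le> s" using step.prems by fastforce
  then show ?case
  proof cases
    case 1
    then have "interval_partition x s [x] \<and> interval_partition s b (x # y # zs)
      \<and> step_sum f [x] + step_sum f (x # y # zs) \<le> step_sum f (x # y # zs)"
      using step by simp
    then show ?thesis by blast
  next
    case 2
    have "f x s + f s y \<le> f x y"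
      using reverse_triangle_onD[OF step.prems(1)] 2 step.hyps by simp
    then have "interval_partition x s [x, s] \<and> interval_partition s b (s # y # zs)
      \<and> step_sum f [x, s] + step_sum f (s # y # zs) \<le> step_sum f (x # y # zs)"
      using 2 step.hyps by (simp add: add.assoc[symmetric] add_right_mono)
    then show ?thesis by blast
  next
    case 3
    have "reverse_triangle_on y b f" "s \<in> {y..b}"
      using reverse_triangle_on_mono[OF step.prems(1)] step 3 by auto
    then obtain us vs where *: "interval_partition y s us" "interval_partition s b vs"
      "step_sum f us + step_sum f vs \<le> step_sum f (y # zs)"
      using step.IH by blast
    obtain us' where us: "us = y # us'" using interval_partition_hd[OF *(1)] by blast
    have "interval_partition x s (x # us) \<and> interval_partition s b vs
      \<and> step_sum f (x # us) + step_sum f vs \<le> step_sum f (x # y # zs)"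
      using * step.hyps unfolding us by (simp add: add.assoc add_left_mono)
    then show ?thesis by blast
  qed
qed

lemma step_sum_le_single_step:
  assumes "interval_partition a b ts" and "reverse_triangle_on a b f" and "a < b"
  shows "step_sum f ts \<le> f a b"
  using assms
proof (induction rule: interval_partition_induct)
  case last
  then show ?case by simp
next
  case (step x y zs)
  show ?case
  proof (cases "y = b")
    case True
    then have "zs = []" using interval_partition_degenerate step.hyps(3) by blast
    then show ?thesis using True by simp
  next
    case False
    then have "y < b" using step.hyps by simp
    then have "step_sum f (y # zs) \<le> f y b"
      using step.IH reverse_triangle_on_mono[OF step.prems(1)] step.hyps by simp
    then have "step_sum f (x # y # zs) \<le> f x y + f y b" by (simp add: add_left_mono)
    also have "\<dots> \<le> f x b"
      using reverse_triangle_onD[OF step.prems(1)] step.hyps \<open>y < b\<close> by simp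
    finally show ?thesis .
  qed
qed

text \<open>Each step is replaced by a fine partition of itself, which by the previous lemma costs no
  more than the step.\<close>

lemma step_sum_fine_refinement:
  assumes "interval_partition a b ts" and "reverse_triangle_on a b f" and "0 < \<delta>"
  shows "\<exists>us. interval_partition a b us \<and> successively (\<lambda>x y. y - x < \<delta>) us
           \<and> step_sum f us \<le> step_sum f ts"
  using assms
proof (induction rule: interval_partition_induct)
  case last
  have "interval_partition b b [b] \<and> successively (\<lambda>x y. y - x < \<delta>) [b]
    \<and> step_sum f [b] \<le> step_sum f [b]" by simp
  then show ?case by blast
next
  case (step x y zs)
  have "reverse_triangle_on y b f" and xy: "reverse_triangle_on x y f"
    using reverse_triangle_on_mono[OF step.prems(1)] step.hyps by auto
  then obtain vs where vs: "interval_partition y b vs" "successively (\<lambda>x y. y - x < \<delta>) vs"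
    "step_sum f vs \<le> step_sum f (y # zs)"
    using step.IH step.prems by blast
  obtain us where us: "interval_partition x y us" "successively (\<lambda>x y. y - x < \<delta>) us"
    using fine_partition_exists[of x y \<delta>] step by auto
  have "step_sum f us \<le> f x y"
    using step_sum_le_single_step[OF us(1) xy] step.hyps by simp
  then have "step_sum f (us @ tl vs) \<le> step_sum f (x # y # zs)"
    using vs(3) by (simp add: step_sum_glue(2)[OF us(1) vs(1)] add_mono)
  then show ?case
    using step_sum_glue(1,3)[OF us(1) vs(1)] us(2) vs(2) by blast
qed

section \<open>The infimum over all partitions\<close>

definition partition_Inf :: "(real \<Rightarrow> real \<Rightarrow> ennreal) \<Rightarrow> real \<Rightarrow> real \<Rightarrow> ennreal" where
  "partition_Inf f a b = Inf {step_sum f ts | ts. interval_partition a b ts}"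

lemma partition_Inf_fine:
  assumes "reverse_triangle_on a b f" and "a < b" and "0 < \<delta>"
  shows "partition_Inf f a b = Inf {step_sum f ts | ts. interval_partition a b ts \<and> mesh ts < \<delta>}"
  unfolding partition_Inf_def
proof (rule antisym)
  show "Inf {step_sum f ts | ts. interval_partition a b ts}
      \<le> Inf {step_sum f ts | ts. interval_partition a b ts \<and> mesh ts < \<delta>}"
    by (rule Inf_superset_mono) blast
  show "Inf {step_sum f ts | ts. interval_partition a b ts \<and> mesh ts < \<delta>}
      \<le> Inf {step_sum f ts | ts. interval_partition a b ts}"
  proof (rule Inf_mono)
    fix v assume "v \<in> {step_sum f ts | ts. interval_partition a b ts}"
    then obtain ts where "interval_partition a b ts" "v = step_sum f ts" by blast
    then obtain us where "interval_partition a b us" "successively (\<lambda>x y. y - x < \<delta>) us"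
      "step_sum f us \<le> v"
      using step_sum_fine_refinement[OF _ assms(1,3)] by blast
    then show "\<exists>u\<in>{step_sum f ts | ts. interval_partition a b ts \<and> mesh ts < \<delta>}. u \<le> v"
      using mesh_less_iff[OF _ assms(2)] by blast
  qed
qed

lemma ennreal_le_add_Inf:
  fixes l :: ennreal
  assumes "\<And>u v. u \<in> A \<Longrightarrow> v \<in> B \<Longrightarrow> l \<le> u + v"
  shows "l \<le> Inf A + Inf B"
proof (rule ennreal_le_epsilon)
  fix e :: real assume fin: "Inf A + Inf B < top" and "0 < e"
  have "\<exists>w\<in>C. w < Inf C + ennreal (e / 2)" if "Inf C < top" for C
  proof -
    have "x < x + ennreal (e / 2)" if "x < top" for x
      using that \<open>0 < e\<close> by (cases x) (auto simp: ennreal_less_iff simp flip: ennreal_plus)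
    from this[OF that] show ?thesis unfolding Inf_less_iff .
  qed
  then obtain u v where "u \<in> A" "u < Inf A + ennreal (e / 2)" "v \<in> B" "v < Inf B + ennreal (e / 2)"
    using fin by (metis ennreal_add_less_top)
  then have "l \<le> (Inf A + ennreal (e / 2)) + (Inf B + ennreal (e / 2))"
    using assms by (meson add_mono less_imp_le order_trans)
  also have "\<dots> = Inf A + Inf B + (ennreal (e / 2) + ennreal (e / 2))"
    by (simp add: ac_simps)
  also have "ennreal (e / 2) + ennreal (e / 2) = ennreal e"
    using \<open>0 < e\<close> by (simp flip: ennreal_plus)
  finally show "l \<le> Inf A + Inf B + ennreal e" .
qed

lemma partition_Inf_additive:
  assumes "reverse_triangle_on a b f" and "s \<in> {a..b}"
  shows "partition_Inf f a b = partition_Inf f a s + partition_Inf f s b"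
proof (rule antisym)
  show "partition_Inf f a b \<le> partition_Inf f a s + partition_Inf f s b"
    unfolding partition_Inf_def[of f a s] partition_Inf_def[of f s b]
  proof (rule ennreal_le_add_Inf)
    fix u v
    assume "u \<in> {step_sum f ts | ts. interval_partition a s ts}"
      and "v \<in> {step_sum f ts | ts. interval_partition s b ts}"
    then obtain us vs where *: "interval_partition a s us" "interval_partition s b vs"
      and "u = step_sum f us" "v = step_sum f vs" by blast
    then have "u + v = step_sum f (us @ tl vs)" by (simp add: step_sum_glue(2)[OF *])
    then show "partition_Inf f a b \<le> u + v"
      unfolding partition_Inf_def using step_sum_glue(1)[OF *] by (blast intro: Inf_lower)
  qed
  show "partition_Inf f a s + partition_Inf f s b \<le> partition_Inf f a b"
    unfolding partition_Inf_def[of f a b]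
  proof (rule Inf_greatest)
    fix v assume "v \<in> {step_sum f ts | ts. interval_partition a b ts}"
    then obtain ts where "interval_partition a b ts" and v: "v = step_sum f ts" by blast
    then obtain us vs where *: "interval_partition a s us" "interval_partition s b vs"
      "step_sum f us + step_sum f vs \<le> v"
      using step_sum_split[OF _ assms] by blast
    have "partition_Inf f a s \<le> step_sum f us" "partition_Inf f s b \<le> step_sum f vs"
      unfolding partition_Inf_def using * by (auto intro: Inf_lower)
    then show "partition_Inf f a s + partition_Inf f s b \<le> v"
      using *(3) by (meson add_mono order_trans)
  qed
qed

text \<open>One inequality suffices for invariance, since it can also be applied to the inverse of \<open>\<phi>\<close>.\<close>

lemma partition_Inf_le_reparametrized:
  assumes "strict_mono_on {c..d} \<phi>" and "\<phi> c = a" and "\<phi> d = b"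
    and "\<And>x y. c \<le> x \<Longrightarrow> x < y \<Longrightarrow> y \<le> d \<Longrightarrow> g x y = f (\<phi> x) (\<phi> y)"
  shows "partition_Inf f a b \<le> partition_Inf g c d"
  unfolding partition_Inf_def
proof (rule Inf_mono)
  fix v assume "v \<in> {step_sum g ts | ts. interval_partition c d ts}"
  then obtain ts where ts: "interval_partition c d ts" and v: "v = step_sum g ts" by blast
  have "interval_partition (\<phi> c) (\<phi> d) (map \<phi> ts)"
    using ts assms(1)
  proof (induction rule: interval_partition_induct)
    case (step x y zs)
    have "strict_mono_on {y..d} \<phi>"
      using step by (auto intro: monotone_on_subset)
    moreover have "\<phi> x < \<phi> y"
      using step by (auto intro: strict_mono_onD)
    ultimately show ?case using step.IH by simp
  qed simp
  moreover have "step_sum f (map \<phi> ts) = v"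
    unfolding v step_sum_map using assms(4) by (intro step_sum_cong[OF ts]) simp
  ultimately show "\<exists>u\<in>{step_sum f ts | ts. interval_partition a b ts}. u \<le> v"
    using assms(2,3) by blast
qed

section \<open>The cost of a step of a causal curve\<close>

definition conformal_cost ::
    "('a \<Rightarrow> 'a \<Rightarrow> ennreal) \<Rightarrow> ('a \<Rightarrow> real) \<Rightarrow> (real \<Rightarrow> 'a) \<Rightarrow> real \<Rightarrow> real \<Rightarrow> ennreal" where
  "conformal_cost \<tau> \<Omega> \<gamma> x y =
     ennreal (GREATEST w. w \<in> (\<lambda>t. \<Omega> (\<gamma> t)) ` {x..y}) * \<tau> (\<gamma> x) (\<gamma> y)"

lemma conformal_variation_eq_step_sum:
  "conformal_variation \<tau> \<Omega> \<gamma> = step_sum (conformal_cost \<tau> \<Omega> \<gamma>)"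
  by (simp add: fun_eq_iff conformal_variation_def step_sum_conv_nth conformal_cost_def)

lemma conformal_length_eq_partition_Inf:
  "conformal_length \<tau> \<Omega> a b \<gamma> = partition_Inf (conformal_cost \<tau> \<Omega> \<gamma>) a b"
  by (simp add: conformal_length_def partition_Inf_def conformal_variation_eq_step_sum)

lemma causal_curve_less:
  assumes "causal_curve le a b \<gamma>"
  shows "a < b"
proof (rule ccontr)
  assume "\<not> a < b"
  then have "{a..b} = {} \<or> {a..b} = {a}" by auto
  then have "\<gamma> constant_on {a..b}" unfolding constant_on_def by auto
  then show False using assms unfolding causal_curve_def by blast
qed

lemma Greatest_image_Icc:
  fixes h :: "real \<Rightarrow> real"
  assumes "continuous_on {x..y} h" and "x \<le> y"
  shows "(GREATEST w. w \<in> h ` {x..y}) \<in> h ` {x..y}"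
    and "t \<in> {x..y} \<Longrightarrow> h t \<le> (GREATEST w. w \<in> h ` {x..y})"
proof -
  obtain m where m: "m \<in> {x..y}" "\<forall>t\<in>{x..y}. h t \<le> h m"
    using continuous_attains_sup[OF compact_Icc _ assms(1)] assms(2) by auto
  have "(GREATEST w. w \<in> h ` {x..y}) = h m"
    using m by (intro Greatest_equality) auto
  then show "(GREATEST w. w \<in> h ` {x..y}) \<in> h ` {x..y}"
    and "t \<in> {x..y} \<Longrightarrow> h t \<le> (GREATEST w. w \<in> h ` {x..y})"
    using m by auto
qed

lemma Greatest_image_Icc_mono:
  fixes h :: "real \<Rightarrow> real"
  assumes "continuous_on {x..z} h" and "x \<le> u" and "u \<le> v" and "v \<le> z"
  shows "(GREATEST w. w \<in> h ` {u..v}) \<le> (GREATEST w. w \<in> h ` {x..z})"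
proof -
  have "continuous_on {u..v} h"
    using assms by (auto intro: continuous_on_subset)
  then obtain t where "t \<in> {u..v}" "(GREATEST w. w \<in> h ` {u..v}) = h t"
    using Greatest_image_Icc(1)[of u v h] assms(3) by blast
  then show ?thesis
    using Greatest_image_Icc(2)[OF assms(1), of t] assms by auto
qed

text \<open>Both maxima over the halves are bounded by the maximum over \<open>[x,z]\<close>, which can then be factored
  out in front of \<open>\<tau>\<close>. Causality of the curve supplies the two relations that the reverse triangle
  inequality for \<open>\<tau>\<close> asks for.\<close>

lemma conformal_cost_reverse_triangle:
  assumes "Lorentzian_pre_length_space ll le \<tau>" and "continuous_on UNIV \<Omega>"
    and "causal_curve le a b \<gamma>"
  shows "reverse_triangle_on a b (conformal_cost \<tau> \<Omega> \<gamma>)"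
  unfolding reverse_triangle_on_def
proof (intro allI impI, elim conjE)
  interpret Lorentzian_pre_length_space ll le \<tau> by fact
  fix x y z assume xyz: "a \<le> x" "x < y" "y < z" "z \<le> b"
  define M where "M u v = ennreal (GREATEST w. w \<in> (\<lambda>t. \<Omega> (\<gamma> t)) ` {u..v})" for u v
  have "continuous_on {a..b} \<gamma>" using assms(3) unfolding causal_curve_def by blast
  then have "continuous_on {a..b} (\<lambda>t. \<Omega> (\<gamma> t))"
    using continuous_on_compose2[OF assms(2)] by blast
  then have cont: "continuous_on {x..z} (\<lambda>t. \<Omega> (\<gamma> t))"
    using xyz by (auto intro: continuous_on_subset)
  have M: "M x y \<le> M x z" "M y z \<le> M x z"
    unfolding M_def using xyz by (auto intro!: ennreal_leI Greatest_image_Icc_mono[OF cont])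
  have "le (\<gamma> x) (\<gamma> y)" "le (\<gamma> y) (\<gamma> z)"
    using assms(3) xyz unfolding causal_curve_def by auto
  note tau = tau_reverse_triangle[OF this]
  have "M x y * \<tau> (\<gamma> x) (\<gamma> y) + M y z * \<tau> (\<gamma> y) (\<gamma> z)
      \<le> M x z * \<tau> (\<gamma> x) (\<gamma> y) + M x z * \<tau> (\<gamma> y) (\<gamma> z)"
    using M by (intro add_mono mult_right_mono) auto
  also have "\<dots> = M x z * (\<tau> (\<gamma> x) (\<gamma> y) + \<tau> (\<gamma> y) (\<gamma> z))"
    by (simp add: distrib_left)
  also have "\<dots> \<le> M x z * \<tau> (\<gamma> x) (\<gamma> z)"
    using tau by (intro mult_left_mono) auto
  finally show "conformal_cost \<tau> \<Omega> \<gamma> x y + conformal_cost \<tau> \<Omega> \<gamma> y z \<le> conformal_cost \<tau> \<Omega> \<gamma> x z"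
    unfolding conformal_cost_def M_def .
qed

section \<open>Reparametrization\<close>

lemma increasing_homeomorphism_Icc:
  fixes \<phi> \<psi> :: "real \<Rightarrow> real"
  assumes "homeomorphism {c..d} {a..b} \<phi> \<psi>" and "mono_on {c..d} \<phi>" and "a \<le> b"
  shows "strict_mono_on {c..d} \<phi>" and "strict_mono_on {a..b} \<psi>"
    and "\<phi> c = a" and "\<phi> d = b" and "\<psi> a = c" and "\<psi> b = d"
    and "\<And>x y. c \<le> x \<Longrightarrow> x \<le> y \<Longrightarrow> y \<le> d \<Longrightarrow> \<phi> ` {x..y} = {\<phi> x..\<phi> y}"
proof -
  have im: "\<phi> ` {c..d} = {a..b}" and im': "\<psi> ` {a..b} = {c..d}"
    and inv: "\<And>x. x \<in> {c..d} \<Longrightarrow> \<psi> (\<phi> x) = x" and inv': "\<And>y. y \<in> {a..b} \<Longrightarrow> \<phi> (\<psi> y) = y"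
    using assms(1) unfolding homeomorphism_def by auto
  have "c \<le> d" using im assms(3) by fastforce
  show strict: "strict_mono_on {c..d} \<phi>"
    using assms(2) inv by (metis inj_on_inverseI strict_mono_iff_mono)
  show strict': "strict_mono_on {a..b} \<psi>"
  proof (rule strict_mono_onI)
    fix x y assume xy: "x \<in> {a..b}" "y \<in> {a..b}" "x < y"
    show "\<psi> x < \<psi> y"
    proof (rule ccontr)
      assume "\<not> \<psi> x < \<psi> y"
      then have "\<phi> (\<psi> y) \<le> \<phi> (\<psi> x)"
        using xy im' by (intro mono_onD[OF assms(2)]) auto
      then show False using inv' xy by simp
    qed
  qed
  show "\<phi> c = a"
  proof (rule antisym)
    have "\<psi> a \<in> {c..d}" using im' assms(3) by auto
    then have "\<phi> c \<le> \<phi> (\<psi> a)" by (intro mono_onD[OF assms(2)]) auto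
    then show "\<phi> c \<le> a" using inv' assms(3) by simp
    show "a \<le> \<phi> c" using im \<open>c \<le> d\<close> by auto
  qed
  then show "\<psi> a = c" using inv[of c] \<open>c \<le> d\<close> by simp
  show "\<phi> d = b"
  proof (rule antisym)
    have "\<psi> b \<in> {c..d}" using im' assms(3) by auto
    then have "\<phi> (\<psi> b) \<le> \<phi> d" by (intro mono_onD[OF assms(2)]) auto
    then show "b \<le> \<phi> d" using inv' assms(3) by simp
    show "\<phi> d \<le> b" using im \<open>c \<le> d\<close> by auto
  qed
  then show "\<psi> b = d" using inv[of d] \<open>c \<le> d\<close> by simp
  show "\<phi> ` {x..y} = {\<phi> x..\<phi> y}" if "c \<le> x" "x \<le> y" "y \<le> d" for x y
  proof
    show "\<phi> ` {x..y} \<subseteq> {\<phi> x..\<phi> y}"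
      using that by (auto intro!: mono_onD[OF assms(2)])
    show "{\<phi> x..\<phi> y} \<subseteq> \<phi> ` {x..y}"
    proof
      fix w assume w: "w \<in> {\<phi> x..\<phi> y}"
      have "\<phi> x \<in> {a..b}" "\<phi> y \<in> {a..b}" using im that by auto
      then have wab: "w \<in> {a..b}" using w by auto
      have "\<psi> (\<phi> x) \<le> \<psi> w" "\<psi> w \<le> \<psi> (\<phi> y)"
        using w wab \<open>\<phi> x \<in> {a..b}\<close> \<open>\<phi> y \<in> {a..b}\<close>
        by (auto intro!: mono_onD[OF strict_mono_on_imp_mono_on[OF strict']])
      then have "\<psi> w \<in> {x..y}" using inv that by auto
      then show "w \<in> \<phi> ` {x..y}" using inv'[OF wab] by (metis imageI)
    qed
  qed
qed

lemma conformal_cost_reparametrized: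
  assumes "\<phi> ` {x..y} = {\<phi> x..\<phi> y}"
  shows "conformal_cost \<tau> \<Omega> (\<gamma> \<circ> \<phi>) x y = conformal_cost \<tau> \<Omega> \<gamma> (\<phi> x) (\<phi> y)"
proof -
  have "(\<lambda>t. \<Omega> ((\<gamma> \<circ> \<phi>) t)) ` {x..y} = (\<lambda>t. \<Omega> (\<gamma> t)) ` {\<phi> x..\<phi> y}"
    unfolding assms[symmetric] by (simp add: image_image)
  then show ?thesis unfolding conformal_cost_def by simp
qed

lemma conformal_length_reparametrized:
  fixes \<phi> \<psi> :: "real \<Rightarrow> real"
  assumes "homeomorphism {c..d} {a..b} \<phi> \<psi>" and "mono_on {c..d} \<phi>" and "a \<le> b"
  shows "conformal_length \<tau> \<Omega> a b \<gamma> = conformal_length \<tau> \<Omega> c d (\<gamma> \<circ> \<phi>)"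
  unfolding conformal_length_eq_partition_Inf
proof (rule antisym)
  note h = increasing_homeomorphism_Icc[OF assms]
  show "partition_Inf (conformal_cost \<tau> \<Omega> \<gamma>) a b
      \<le> partition_Inf (conformal_cost \<tau> \<Omega> (\<gamma> \<circ> \<phi>)) c d"
    using h by (intro partition_Inf_le_reparametrized[of c d \<phi>] conformal_cost_reparametrized) auto
  have inv: "\<phi> (\<psi> t) = t" "\<psi> t \<in> {c..d}" if "t \<in> {a..b}" for t
    using assms(1) that unfolding homeomorphism_def by auto
  show "partition_Inf (conformal_cost \<tau> \<Omega> (\<gamma> \<circ> \<phi>)) c d
      \<le> partition_Inf (conformal_cost \<tau> \<Omega> \<gamma>) a b"
  proof (rule partition_Inf_le_reparametrized[of a b \<psi>])
    fix x y assume xy: "a \<le> x" "x < y" "y \<le> b"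
    then have "\<psi> x < \<psi> y" by (intro strict_mono_onD[OF h(2)]) auto
    then have "conformal_cost \<tau> \<Omega> (\<gamma> \<circ> \<phi>) (\<psi> x) (\<psi> y)
        = conformal_cost \<tau> \<Omega> \<gamma> (\<phi> (\<psi> x)) (\<phi> (\<psi> y))"
      using xy inv(2)[of x] inv(2)[of y] by (intro conformal_cost_reparametrized h(7)) auto
    then show "conformal_cost \<tau> \<Omega> \<gamma> x y = conformal_cost \<tau> \<Omega> (\<gamma> \<circ> \<phi>) (\<psi> x) (\<psi> y)"
      using inv(1) xy by simp
  qed (use h in auto)
qed

section \<open>Properties of the conformal length\<close>

theorem proposition3p4:
  fixes ll le :: "'a::metric_space \<Rightarrow> 'a \<Rightarrow> bool"
    and \<tau> :: "'a \<Rightarrow> 'a \<Rightarrow> ennreal"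
    and \<Omega> :: "'a \<Rightarrow> real"
  assumes "Lorentzian_pre_length_space ll le \<tau>"
    and "continuous_on UNIV \<Omega>"
    and "\<forall>x. 0 < \<Omega> x"
  shows "(\<forall>a b \<gamma> \<delta>. causal_curve le a b \<gamma> \<and> 0 < \<delta> \<longrightarrow>
            conformal_length \<tau> \<Omega> a b \<gamma> =
              Inf {conformal_variation \<tau> \<Omega> \<gamma> ts | ts. interval_partition a b ts \<and> mesh ts < \<delta>})
       \<and> (\<forall>a b \<gamma> s. causal_curve le a b \<gamma> \<and> s \<in> {a..b} \<longrightarrow>
            conformal_length \<tau> \<Omega> a b \<gamma> =
              conformal_length \<tau> \<Omega> a s \<gamma> + conformal_length \<tau> \<Omega> s b \<gamma>)
       \<and> (\<forall>a b \<gamma> c d' \<phi>. causal_curve le a b \<gamma> \<and>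
            mono_on {c..d'} \<phi> \<and>
            (\<exists>C. C-lipschitz_on {c..d'} \<phi>) \<and>
            (\<exists>\<psi>. homeomorphism {c..d'} {a..b} \<phi> \<psi>) \<longrightarrow>
            conformal_length \<tau> \<Omega> a b \<gamma> = conformal_length \<tau> \<Omega> c d' (\<gamma> \<circ> \<phi>))"
proof (intro conjI allI impI; (elim conjE exE)?)
  fix a b \<gamma> and \<delta> :: real assume "causal_curve le a b \<gamma>" and "0 < \<delta>"
  then show "conformal_length \<tau> \<Omega> a b \<gamma> =
      Inf {conformal_variation \<tau> \<Omega> \<gamma> ts | ts. interval_partition a b ts \<and> mesh ts < \<delta>}"
    unfolding conformal_length_eq_partition_Inf conformal_variation_eq_step_sum
    using conformal_cost_reverse_triangle[OF assms(1,2)] causal_curve_less partition_Inf_fine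
    by blast
next
  fix a b \<gamma> s assume "causal_curve le a b \<gamma>" and "s \<in> {a..b}"
  then show "conformal_length \<tau> \<Omega> a b \<gamma> = conformal_length \<tau> \<Omega> a s \<gamma> + conformal_length \<tau> \<Omega> s b \<gamma>"
    unfolding conformal_length_eq_partition_Inf
    using conformal_cost_reverse_triangle[OF assms(1,2)] partition_Inf_additive by blast
next
  fix a b c d' and \<gamma> :: "real \<Rightarrow> 'a" and \<phi> \<psi> :: "real \<Rightarrow> real"
  assume "causal_curve le a b \<gamma>" and "mono_on {c..d'} \<phi>" and "homeomorphism {c..d'} {a..b} \<phi> \<psi>"
  then show "conformal_length \<tau> \<Omega> a b \<gamma> = conformal_length \<tau> \<Omega> c d' (\<gamma> \<circ> \<phi>)"
    using conformal_length_reparametrized causal_curve_less less_imp_le by metis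
qed

end
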